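(* Let $G$ be a finite abelian group with $b\ge2$ elements, $s,m\ge1$ and $n\ge m$ integers, and let $P\subset\mathbb{X}_n^s$ be an arbitrary subset of cardinality $b^m$ which is a strict $(t,m,s)$-net in base $b$. Define $\widehat N_a$, $0\le a\le ns$, by $$\sum_{a=0}^{ns}\widehat N_az^a=\frac1{\#(P)}\sum_{X=(x_1,\ldots,x_s)^\top\in P}\ \prod_{i=1}^sp(\mu^*(x_i);z),$$ where for integers $0\le h\le n$ $$p(h;z):=\begin{cases}1+\sum_{a=1}^n z^a(b^a-b^{a-1}) & \text{if } h=0,\\ 1+\sum_{a=1}^{h-1}z^a(b^a-b^{a-1})-z^hb^{h-1} & \text{if } h>0.\end{cases}$$ Then $$t\ge m+1-\min\{a:1\le a\le ns,\ \widehat N_a\ne0\},$$ where the minimum is defined as $ns+1$ if $\widehat N_1=\cdots=\widehat N_{ns}=0$.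
   Context: $\mathbb{X}_n:=G^n$, and $\mathbb{X}_n^s$ is identified with $s\times n$ matrices $X=(\xi_{i,j})$ over $G$, with rows $x_1,\ldots,x_s\in\mathbb{X}_n$. For $x=(\xi_1,\ldots,\xi_n)\in\mathbb{X}_n$, $\mu^*(x)=\min\{i:\xi_i\ne0\}$ if $x\ne0$ and $\mu^*(0)=0$. Nets: a set of $b^m$ points in $[0,1)^s$ is a $(t,m,s)$-net in base $b$ ($0\le t\le m$ an integer) if for all integers $d_1,\ldots,d_s\ge0$ with $d_1+\cdots+d_s=m-t$ and all integers $0\le a_i<b^{d_i}$, the interval $\prod_{i=1}^s[a_i b^{-d_i},(a_i+1)b^{-d_i})$ contains exactly $b^t$ of the points. Fix a bijection $\varphi:\{0,\ldots,b-1\}\to G$ with $\varphi(0)=0$; it induces the injection $\varphi^{-1}:\mathbb{X}_n^s\to[0,1)^s$ sending $X$ to the point with $i$-th coordinate $\sum_{j=1}^n\varphi^{-1}(\xi_{i,j})b^{-j}$. A subset $P\subset\mathbb{X}_n^s$ is a $(t,m,s)$-net in base $b$ if $\varphi^{-1}(P)$ is; it is strict if $t$ is the smallest value for which this holds. *)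

theory Defs
  imports "HOL-Library.FuncSet" "HOL-Library.Cardinality" "HOL-Computational_Algebra.Polynomial"
begin

text \<open>
  Vectors of length \<open>n\<close> and \<open>s \<times> n\<close> matrices over \<open>G\<close> are extensional functions on
  \<open>{1..n}\<close> and \<open>{1..s}\<close>, so that equality and cardinality of sets of them are the intended ones.
\<close>

definition vecs :: "nat \<Rightarrow> (nat \<Rightarrow> 'g) set" where
  "vecs n = ({1..n} \<rightarrow>\<^sub>E UNIV)"

definition mats :: "nat \<Rightarrow> nat \<Rightarrow> (nat \<Rightarrow> nat \<Rightarrow> 'g) set" where
  "mats s n = ({1..s} \<rightarrow>\<^sub>E vecs n)"

definition mu_star :: "nat \<Rightarrow> (nat \<Rightarrow> 'g::zero) \<Rightarrow> nat" where
  "mu_star n x = (if \<exists>i\<in>{1..n}. x i \<noteq> 0 then Min {i\<in>{1..n}. x i \<noteq> 0} else 0)"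

definition unit_cube :: "nat \<Rightarrow> (nat \<Rightarrow> real) set" where
  "unit_cube s = ({1..s} \<rightarrow>\<^sub>E {0..<1})"

definition elem_interval :: "nat \<Rightarrow> nat \<Rightarrow> (nat \<Rightarrow> nat) \<Rightarrow> (nat \<Rightarrow> nat) \<Rightarrow> (nat \<Rightarrow> real) set" where
  "elem_interval b s d a =
     (\<Pi>\<^sub>E i\<in>{1..s}. {real (a i) / real b ^ d i ..< (real (a i) + 1) / real b ^ d i})"

definition is_net :: "nat \<Rightarrow> nat \<Rightarrow> nat \<Rightarrow> nat \<Rightarrow> (nat \<Rightarrow> real) set \<Rightarrow> bool" where
  "is_net b t m s S \<longleftrightarrow>
     t \<le> m \<and> S \<subseteq> unit_cube s \<and> card S = b ^ m \<and>
     (\<forall>d a. (\<Sum>i=1..s. d i) = m - t \<and> (\<forall>i\<in>{1..s}. a i < b ^ d i) \<longrightarrow>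
        card (S \<inter> elem_interval b s d a) = b ^ t)"

definition mat_point ::
  "nat \<Rightarrow> (nat \<Rightarrow> 'g) \<Rightarrow> nat \<Rightarrow> nat \<Rightarrow> (nat \<Rightarrow> nat \<Rightarrow> 'g) \<Rightarrow> (nat \<Rightarrow> real)" where
  "mat_point b \<phi> s n X =
     (\<lambda>i\<in>{1..s}. \<Sum>j=1..n. real (inv_into {..<b} \<phi> (X i j)) / real b ^ j)"

definition is_mat_net ::
  "nat \<Rightarrow> (nat \<Rightarrow> 'g) \<Rightarrow> nat \<Rightarrow> nat \<Rightarrow> nat \<Rightarrow> nat \<Rightarrow> (nat \<Rightarrow> nat \<Rightarrow> 'g) set \<Rightarrow> bool" where
  "is_mat_net b \<phi> n t m s P \<longleftrightarrow> is_net b t m s (mat_point b \<phi> s n ` P)"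

definition is_strict_mat_net ::
  "nat \<Rightarrow> (nat \<Rightarrow> 'g) \<Rightarrow> nat \<Rightarrow> nat \<Rightarrow> nat \<Rightarrow> nat \<Rightarrow> (nat \<Rightarrow> nat \<Rightarrow> 'g) set \<Rightarrow> bool" where
  "is_strict_mat_net b \<phi> n t m s P \<longleftrightarrow>
     is_mat_net b \<phi> n t m s P \<and> (\<forall>t'. is_mat_net b \<phi> n t' m s P \<longrightarrow> t \<le> t')"

definition p_poly :: "nat \<Rightarrow> nat \<Rightarrow> nat \<Rightarrow> real poly" where
  "p_poly b n h =
     (if h = 0 then 1 + (\<Sum>a=1..n. monom (real b ^ a - real b ^ (a - 1)) a)
      else 1 + (\<Sum>a=1..h - 1. monom (real b ^ a - real b ^ (a - 1)) a) - monom (real b ^ (h - 1)) h)"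

definition N_poly :: "nat \<Rightarrow> nat \<Rightarrow> nat \<Rightarrow> (nat \<Rightarrow> nat \<Rightarrow> 'g::zero) set \<Rightarrow> real poly" where
  "N_poly b s n P =
     smult (1 / real (card P)) (\<Sum>X\<in>P. \<Prod>i=1..s. p_poly b n (mu_star n (X i)))"

definition N_hat :: "nat \<Rightarrow> nat \<Rightarrow> nat \<Rightarrow> (nat \<Rightarrow> nat \<Rightarrow> 'g::zero) set \<Rightarrow> nat \<Rightarrow> real" where
  "N_hat b s n P a = coeff (N_poly b s n P) a"

definition min_weight :: "nat \<Rightarrow> nat \<Rightarrow> nat \<Rightarrow> (nat \<Rightarrow> nat \<Rightarrow> 'g::zero) set \<Rightarrow> nat" where
  "min_weight b s n P =
     (let A = {a\<in>{1..n * s}. N_hat b s n P a \<noteq> 0} in if A = {} then n * s + 1 else Min A)"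

lemma mu_star_le: "mu_star n x \<le> n"
proof (cases "\<exists>i\<in>{1..n}. x i \<noteq> 0")
  case True
  then have "Min {i\<in>{1..n}. x i \<noteq> 0} \<in> {i\<in>{1..n}. x i \<noteq> 0}" by (intro Min_in) auto
  then show ?thesis using True by (simp add: mu_star_def)
qed (simp add: mu_star_def)

lemma degree_p_poly: "h \<le> n \<Longrightarrow> degree (p_poly b n h) \<le> n"
proof -
  assume "h \<le> n"
  have "degree (monom c a :: real poly) \<le> n" if "a \<le> n" for c a
    using degree_monom_le that by (rule order_trans)
  with \<open>h \<le> n\<close> show ?thesis
    unfolding p_poly_def by (auto intro!: degree_add_le degree_diff_le degree_sum_le)
qed

text \<open>
  The polynomial has degree at most \<open>n * s\<close>, so its coefficients up to \<open>n * s\<close> are the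
  numbers determined by the generating function identity.
\<close>

lemma N_hat_generating:
  fixes P :: "(nat \<Rightarrow> nat \<Rightarrow> 'g::zero) set"
  shows "(\<Sum>a=0..n * s. N_hat b s n P a * z ^ a) =
    1 / real (card P) * (\<Sum>X\<in>P. \<Prod>i=1..s. poly (p_poly b n (mu_star n (X i))) z)"
proof -
  have "degree (\<Prod>i=1..s. p_poly b n (mu_star n (X i))) \<le> n * s" for X :: "nat \<Rightarrow> nat \<Rightarrow> 'g"
  proof -
    have "degree (\<Prod>i=1..s. p_poly b n (mu_star n (X i)))
        \<le> (\<Sum>i=1..s. degree (p_poly b n (mu_star n (X i))))"
      by (rule degree_prod_sum_le[unfolded o_def]) simp
    also have "\<dots> \<le> (\<Sum>i=1..s. n)"
      by (intro sum_mono degree_p_poly mu_star_le)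
    finally show ?thesis by (simp add: mult.commute)
  qed
  then have "degree (N_poly b s n P) \<le> n * s"
    unfolding N_poly_def
    by (cases "finite P") (auto intro!: order_trans[OF degree_smult_le] degree_sum_le)
  then have "poly (N_poly b s n P) z = (\<Sum>a=0..n * s. N_hat b s n P a * z ^ a)"
    unfolding N_hat_def poly_altdef atMost_atLeast0
    by (intro sum.mono_neutral_left) (auto simp: coeff_eq_0)
  then show ?thesis by (simp add: N_poly_def poly_sum poly_prod)
qed

end

(* The coefficient of z^a in p(h;z) is e_a(h) - e_(a-1)(h), where e_a(h) is b^a if the first a
   coordinates of a vector with mu_star value h vanish, and 0 otherwise.  For a net, the average over P
   of a product of e_(d_i)(x_i) counts the points of an elementary interval at the origin and equals 1
   whenever d_1 + ... + d_s <= m - t.  All differences therefore average out, so the coefficients of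
   z^1, ..., z^(m-t) vanish. *)

theory Submission
  imports Defs
begin

text \<open>Induction over the factors. In the Cauchy product, the coefficient of the split-off
  factor \<open>p j\<close> at \<open>a > 0\<close> is a difference of two \<open>e j\<close> values
  whose weighted sums both equal \<open>C\<close>, so only \<open>a = 0\<close> survives. The weight
  \<open>w\<close> is arbitrary so that it can absorb the coefficient of the factor removed.\<close>

lemma coeff_sum_smult_prod_telescope:
  fixes p :: "'i \<Rightarrow> 'x \<Rightarrow> real poly" and e :: "'i \<Rightarrow> nat \<Rightarrow> 'x \<Rightarrow> real"
  assumes "finite A"
    and "\<And>i x a. i \<in> A \<Longrightarrow> a \<le> K \<Longrightarrow>
      coeff (p i x) a = (if a = 0 then e i 0 x else e i a x - e i (a - 1) x)"
    and "\<And>d. sum d A \<le> K \<Longrightarrow> (\<Sum>x\<in>P. w x * (\<Prod>i\<in>A. e i (d i) x)) = C"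
    and "k \<le> K"
  shows "coeff (\<Sum>x\<in>P. smult (w x) (\<Prod>i\<in>A. p i x)) k = (if k = 0 then C else 0)"
  using assms
proof (induction A arbitrary: w C K k rule: finite_induct)
  case empty
  from empty(2)[of "\<lambda>_. 0"] show ?case
    by (cases k) (auto simp: coeff_sum)
next
  case (insert j A)
  have coeffs: "coeff (\<Sum>x\<in>P. smult (w x * coeff (p j x) a) (\<Prod>i\<in>A. p i x)) (k - a)
      = (if k - a = 0 then if a = 0 then C else 0 else 0)" if "a \<le> k" for a
  \<comment> \<open>Degree \<open>a\<close> spent on the factor \<open>j\<close> leaves
    \<open>K - a\<close> for the others. With the new weight, the common value of the sums is
    \<open>C\<close> for \<open>a = 0\<close> and 0 otherwise.\<close>
  proof (rule insert.IH[where K = "K - a"])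
    fix i x a' assume "i \<in> A" "a' \<le> K - a"
    then show "coeff (p i x) a' = (if a' = 0 then e i 0 x else e i a' x - e i (a' - 1) x)"
      by (intro insert.prems(1)) auto
  next
    fix d :: "'i \<Rightarrow> nat" assume d: "sum d A \<le> K - a"
    \<comment> \<open>Giving \<open>j\<close> any exponent \<open>a' \<le> a\<close> keeps the total
      within \<open>K\<close>. Taking both \<open>a\<close> and \<open>a - 1\<close> makes the
      difference cancel.\<close>
    have shift: "(\<Sum>x\<in>P. w x * (e j a' x * (\<Prod>i\<in>A. e i (d i) x))) = C" if "a' \<le> a" for a'
    proof -
      have "(\<Prod>i\<in>A. e i ((d(j := a')) i) x) = (\<Prod>i\<in>A. e i (d i) x)" for x
        using insert.hyps(2) by (intro prod.cong) auto
      moreover have "sum (d(j := a')) A = sum d A"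
        using insert.hyps(2) by (intro sum.cong) auto
      ultimately show ?thesis
        using insert.prems(2)[of "d(j := a')"] insert.hyps d that \<open>a \<le> k\<close> \<open>k \<le> K\<close> by simp
    qed
    have "coeff (p j x) a = (if a = 0 then e j 0 x else e j a x - e j (a - 1) x)" for x
      using insert.prems(1,3) that by simp
    then show "(\<Sum>x\<in>P. w x * coeff (p j x) a * (\<Prod>i\<in>A. e i (d i) x)) = (if a = 0 then C else 0)"
      using shift[of a] shift[of "a - 1"]
      by (auto simp: algebra_simps sum_subtractf)
  qed (use that \<open>k \<le> K\<close> in auto)
  have "coeff (\<Sum>x\<in>P. smult (w x) (\<Prod>i\<in>insert j A. p i x)) k
      = (\<Sum>x\<in>P. \<Sum>a\<le>k. w x * (coeff (p j x) a * coeff (\<Prod>i\<in>A. p i x) (k - a)))"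
    using insert.hyps by (simp add: coeff_sum coeff_mult sum_distrib_left)
  also have "\<dots> = (\<Sum>a\<le>k. coeff (\<Sum>x\<in>P. smult (w x * coeff (p j x) a) (\<Prod>i\<in>A. p i x)) (k - a))"
    by (subst sum.swap) (simp add: coeff_sum mult.assoc)
  also have "\<dots> = (\<Sum>a\<le>k. if a = 0 then if k = 0 then C else 0 else 0)"
    by (intro sum.cong refl) (auto simp: coeffs)
  also have "\<dots> = (if k = 0 then C else 0)"
    by simp
  finally show ?case .
qed

text \<open>The irregular last term of \<open>p_poly\<close> for \<open>h > 0\<close> is the
  telescoping difference at \<open>a = h\<close>, where \<open>e h = 0\<close> and
  \<open>e (h - 1) = b ^ (h - 1)\<close>. Beyond \<open>h\<close> both terms vanish.\<close>

lemma coeff_p_poly: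
  fixes b h n a :: nat
  assumes "h \<le> n" "a \<le> n"
  defines "e \<equiv> \<lambda>a. if h = 0 \<or> a < h then real b ^ a else 0"
  shows "coeff (p_poly b n h) a = (if a = 0 then e 0 else e a - e (a - 1))"
proof -
  have *: "coeff (\<Sum>a=1..l. monom (real b ^ a - real b ^ (a - 1)) a) k
      = (if k \<in> {1..l} then real b ^ k - real b ^ (k - 1) else 0)" for l k
    by (simp add: coeff_sum)
  show ?thesis
    using assms(1,2) unfolding p_poly_def e_def
    by (auto simp: * coeff_1 simp del: One_nat_def split: if_splits)
qed

text \<open>The value 0 of \<open>mu_star\<close> encodes the zero vector, which has leading zeros
  of every length; hence the separate disjunct.\<close>

lemma mu_star_zero_or_greater_iff:
  assumes "d \<le> n"
  shows "mu_star n x = 0 \<or> d < mu_star n x \<longleftrightarrow> (\<forall>j\<in>{1..d}. x j = 0)"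
proof (cases "\<exists>i\<in>{1..n}. x i \<noteq> 0")
  case True
  let ?S = "{i\<in>{1..n}. x i \<noteq> 0}"
  have ne: "?S \<noteq> {}" using True by auto
  have mu: "mu_star n x = Min ?S" using True by (simp add: mu_star_def)
  have "Min ?S \<in> ?S" using ne by (intro Min_in) auto
  moreover have "d < Min ?S \<longleftrightarrow> (\<forall>i\<in>?S. d < i)" using ne by (intro Min_gr_iff) auto
  ultimately show ?thesis using assms unfolding mu by force
next
  case False
  then show ?thesis using assms by (auto simp: mu_star_def)
qed

text \<open>A digit is at most \<open>b - 1\<close>, and
  \<open>(b - 1) / b ^ j = 1 / b ^ (j - 1) - 1 / b ^ j\<close> telescopes. The subtracted last term
  later gives a strict bound.\<close>

lemma sum_digits_le:
  fixes c :: "nat \<Rightarrow> nat"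
  assumes "b \<ge> 2" "\<And>j. c j < b"
  shows "(\<Sum>j=Suc d..d + k. real (c j) / real b ^ j) \<le> 1 / real b ^ d - 1 / real b ^ (d + k)"
proof (induction k)
  case (Suc k)
  have "real (c (d + Suc k)) \<le> real b - 1"
    using assms(2)[of "d + Suc k"] by linarith
  then have "real (c (d + Suc k)) / real b ^ (d + Suc k) \<le> (real b - 1) / real b ^ (d + Suc k)"
    by (intro divide_right_mono) auto
  also have "\<dots> = 1 / real b ^ (d + k) - 1 / real b ^ (d + Suc k)"
    using assms(1) by (simp add: field_simps)
  finally show ?case using Suc by simp
qed simp

text \<open>A nonzero digit at a position \<open>j \<le> d\<close> alone contributes at least
  \<open>1 / b ^ d\<close>, while all digits after position \<open>d\<close> together stay strictly
  below that.\<close>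

lemma digit_expansion_less_iff:
  fixes c :: "nat \<Rightarrow> nat"
  assumes b: "b \<ge> 2" and c: "\<And>j. c j < b" and "d \<le> n"
  shows "(\<Sum>j=1..n. real (c j) / real b ^ j) < 1 / real b ^ d \<longleftrightarrow> (\<forall>j\<in>{1..d}. c j = 0)"
proof
  assume less: "(\<Sum>j=1..n. real (c j) / real b ^ j) < 1 / real b ^ d"
  show "\<forall>j\<in>{1..d}. c j = 0"
  proof (rule ballI, rule ccontr)
    fix j assume j: "j \<in> {1..d}" "c j \<noteq> 0"
    have "1 / real b ^ d \<le> 1 / real b ^ j"
      using b j by (intro divide_left_mono power_increasing) auto
    also have "\<dots> \<le> real (c j) / real b ^ j"
      using j by (intro divide_right_mono) auto
    also have "\<dots> \<le> (\<Sum>j=1..n. real (c j) / real b ^ j)"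
      using j \<open>d \<le> n\<close> by (intro member_le_sum) auto
    finally show False using less by simp
  qed
next
  assume zero: "\<forall>j\<in>{1..d}. c j = 0"
  have "(\<Sum>j=1..n. real (c j) / real b ^ j) = (\<Sum>j=Suc d..d + (n - d). real (c j) / real b ^ j)"
    using zero \<open>d \<le> n\<close> by (intro sum.mono_neutral_right) auto
  also have "\<dots> \<le> 1 / real b ^ d - 1 / real b ^ (d + (n - d))"
    using b c by (rule sum_digits_le)
  also have "\<dots> < 1 / real b ^ d" using b by simp
  finally show "(\<Sum>j=1..n. real (c j) / real b ^ j) < 1 / real b ^ d" .
qed

lemma mat_point_in_elem_interval_origin_iff:
  fixes \<phi> :: "nat \<Rightarrow> 'g::zero"
  assumes b: "b \<ge> 2" and \<phi>: "bij_betw \<phi> {..<b} UNIV" "\<phi> 0 = 0"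
    and d: "\<And>i. i \<in> {1..s} \<Longrightarrow> d i \<le> n"
  shows "mat_point b \<phi> s n X \<in> elem_interval b s d (\<lambda>_. 0) \<longleftrightarrow>
    (\<forall>i\<in>{1..s}. mu_star n (X i) = 0 \<or> d i < mu_star n (X i))"
proof -
  have inv_less: "inv_into {..<b} \<phi> g < b" for g
    using inv_into_into[of g \<phi> "{..<b}"] \<phi>(1) by (auto simp: bij_betw_def)
  \<comment> \<open>Since \<open>\<phi> 0 = 0\<close>, vanishing digits are exactly vanishing
    entries, so leading zeros of the expansion are leading zeros of the row.\<close>
  have inv_zero: "inv_into {..<b} \<phi> g = 0 \<longleftrightarrow> g = 0" for g
    using \<phi> b by (metis UNIV_I bij_betw_inv_into_left bij_betw_inv_into_right lessThan_iff
        less_le_trans zero_less_numeral)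
  have "mat_point b \<phi> s n X \<in> elem_interval b s d (\<lambda>_. 0) \<longleftrightarrow>
    (\<forall>i\<in>{1..s}. (\<Sum>j=1..n. real (inv_into {..<b} \<phi> (X i j)) / real b ^ j) < 1 / real b ^ d i)"
    by (auto simp: mat_point_def elem_interval_def PiE_iff intro!: sum_nonneg)
  also have "\<dots> \<longleftrightarrow> (\<forall>i\<in>{1..s}. mu_star n (X i) = 0 \<or> d i < mu_star n (X i))"
  proof (intro ball_cong refl)
    fix i assume i: "i \<in> {1..s}"
    show "(\<Sum>j=1..n. real (inv_into {..<b} \<phi> (X i j)) / real b ^ j) < 1 / real b ^ d i \<longleftrightarrow>
        mu_star n (X i) = 0 \<or> d i < mu_star n (X i)"
      unfolding mu_star_zero_or_greater_iff[OF d[OF i]]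
      using digit_expansion_less_iff[OF b inv_less d[OF i], of "\<lambda>j. X i j"] inv_zero by simp
  qed
  finally show ?thesis .
qed

text \<open>The floor form turns refinement and disjointness of intervals into statements about
  integers.\<close>

lemma in_elementary_interval_iff_floor:
  fixes x :: real
  assumes "b > 0"
  shows "x \<in> {real c / real b ^ l ..< (real c + 1) / real b ^ l} \<longleftrightarrow> \<lfloor>x * real b ^ l\<rfloor> = int c"
  using assms by (auto simp: floor_eq_iff field_simps)

text \<open>The net property speaks only of exponents with sum exactly \<open>m - t\<close>. A
  coarser box at the origin is cut along its first coordinate into \<open>b ^ r\<close> cells of
  that kind, where \<open>r\<close> is the missing amount, and each cell holds \<open>b ^ t\<close>
  points.\<close>

lemma net_card_elem_interval_origin:
  assumes net: "is_net b t m s S" and b: "b \<ge> 2" and s: "s \<ge> 1"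
    and d: "(\<Sum>i=1..s. d i) \<le> m - t"
  shows "card (S \<inter> elem_interval b s d (\<lambda>_. 0)) = b ^ (m - (\<Sum>i=1..s. d i))"
proof -
  define r where "r = m - t - (\<Sum>i=1..s. d i)"
  define d' where "d' = d(1 := d 1 + r)"
  define a where "a c = ((\<lambda>_. 0)(1 := c) :: nat \<Rightarrow> nat)" for c
  have tm: "t \<le> m" and card_S: "card S = b ^ m" using net by (auto simp: is_net_def)
  have fin: "finite S" using card_S b by (intro card_ge_0_finite) simp
  have range: "{1..s} = insert 1 {2..s}" using s by auto
  have rest: "(\<Sum>i=2..s. d' i) = (\<Sum>i=2..s. d i)" by (intro sum.cong) (auto simp: d'_def)
  have sum_range: "(\<Sum>i=1..s. f i) = f 1 + (\<Sum>i=2..s. f i)" for f :: "nat \<Rightarrow> nat"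
    unfolding range by simp
  have d'_sum: "(\<Sum>i=1..s. d' i) = m - t"
    using d rest unfolding r_def sum_range by (simp add: d'_def r_def sum_range del: One_nat_def)
  have cell: "card (S \<inter> elem_interval b s d' (a c)) = b ^ t" if c: "c < b ^ r" for c
  proof -
    have "b ^ r \<le> b ^ (d 1 + r)" using b by (intro power_increasing) auto
    with c have "c < b ^ (d 1 + r)" by (rule less_le_trans)
    then have "\<forall>i\<in>{1..s}. a c i < b ^ d' i"
      using b by (auto simp: a_def d'_def)
    then show ?thesis using net d'_sum unfolding is_net_def by blast
  qed
  \<comment> \<open>The first side of the coarse box is the union of the first \<open>b ^ r\<close>
    intervals of the finer resolution.\<close>
  have first: "\<lfloor>y * real b ^ d 1\<rfloor> = 0 \<longleftrightarrow> (\<exists>c<b ^ r. \<lfloor>y * real b ^ (d 1 + r)\<rfloor> = int c)" for y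
  proof -
    let ?v = "y * real b ^ (d 1 + r)"
    have not_le_0: "\<not> real b ^ l \<le> 0" for l using b by (simp add: not_le)
    have "(\<exists>c<b ^ r. \<lfloor>?v\<rfloor> = int c) \<longleftrightarrow> 0 \<le> \<lfloor>?v\<rfloor> \<and> \<lfloor>?v\<rfloor> < int (b ^ r)"
      by (metis of_nat_0_le_iff of_nat_less_iff zero_le_imp_eq_int)
    also have "\<dots> \<longleftrightarrow> 0 \<le> ?v \<and> ?v < real b ^ r"
      by (simp add: floor_less_iff)
    also have "\<dots> \<longleftrightarrow> 0 \<le> y * real b ^ d 1 \<and> y * real b ^ d 1 < 1"
      using b by (simp add: power_add zero_le_mult_iff not_le_0 flip: mult.assoc)
    finally show ?thesis by (simp add: floor_eq_iff)
  qed
  have interval: "x \<in> elem_interval b s d'' a' \<longleftrightarrow>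
      x \<in> extensional {1..s} \<and> \<lfloor>x 1 * real b ^ d'' 1\<rfloor> = int (a' 1) \<and>
      (\<forall>i\<in>{2..s}. \<lfloor>x i * real b ^ d'' i\<rfloor> = int (a' i))" for x d'' a'
    using b unfolding elem_interval_def PiE_iff range
    by (subst in_elementary_interval_iff_floor) auto
  have split: "elem_interval b s d (\<lambda>_. 0) = (\<Union>c<b ^ r. elem_interval b s d' (a c))"
    using first by (auto simp: interval d'_def a_def)
  have "card (S \<inter> elem_interval b s d (\<lambda>_. 0)) = card (\<Union>c<b ^ r. S \<inter> elem_interval b s d' (a c))"
    by (simp add: split)
  \<comment> \<open>The cells are disjoint because the floor of the scaled first coordinate
    determines \<open>c\<close>.\<close>
  also have "\<dots> = (\<Sum>c<b ^ r. card (S \<inter> elem_interval b s d' (a c)))"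
    using fin by (intro card_UN_disjoint) (auto simp: interval a_def)
  also have "\<dots> = b ^ (r + t)" by (simp add: cell power_add)
  also have "r + t = m - (\<Sum>i=1..s. d i)" using d tm by (simp add: r_def)
  finally show ?thesis .
qed

lemma N_hat_eq_0_of_mat_net:
  fixes P :: "(nat \<Rightarrow> nat \<Rightarrow> 'g::zero) set"
  assumes b: "b \<ge> 2" and s: "s \<ge> 1" and nm: "n \<ge> m"
    and \<phi>: "bij_betw \<phi> {..<b} UNIV" "\<phi> 0 = 0"
    and card_P: "card P = b ^ m" and net: "is_mat_net b \<phi> n t m s P"
    and k: "1 \<le> k" "k \<le> m - t"
  shows "N_hat b s n P k = 0"
proof -
  define e :: "nat \<Rightarrow> nat \<Rightarrow> (nat \<Rightarrow> nat \<Rightarrow> 'g) \<Rightarrow> real"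
    where "e i a X = (if mu_star n (X i) = 0 \<or> a < mu_star n (X i) then real b ^ a else 0)" for i a X
  let ?S = "mat_point b \<phi> s n ` P"
  have net': "is_net b t m s ?S" using net by (simp add: is_mat_net_def)
  have fin: "finite P" using card_P b by (intro card_ge_0_finite) simp
  \<comment> \<open>\<open>P\<close> and its image both have \<open>b ^ m\<close> elements, so
    counting matrices is counting points.\<close>
  have inj: "inj_on (mat_point b \<phi> s n) P"
    using net' card_P fin by (intro eq_card_imp_inj_on) (auto simp: is_net_def)
  \<comment> \<open>The product is \<open>b ^ ?D\<close> times the indicator of the box, which
    contains \<open>b ^ (m - ?D)\<close> points. The total \<open>b ^ m\<close> does not depend on
    \<open>d\<close>, as the telescoping requires.\<close>
  have count: "(\<Sum>X\<in>P. 1 * (\<Prod>i=1..s. e i (d i) X)) = real (b ^ m)"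
    if d: "(\<Sum>i=1..s. d i) \<le> m - t" for d
  proof -
    let ?D = "\<Sum>i=1..s. d i" and ?I = "elem_interval b s d (\<lambda>_. 0)"
    have dn: "d i \<le> n" if "i \<in> {1..s}" for i
      using member_le_sum[of i "{1..s}" d] that d nm by simp
    have in_I: "mat_point b \<phi> s n X \<in> ?I \<longleftrightarrow>
        (\<forall>i\<in>{1..s}. mu_star n (X i) = 0 \<or> d i < mu_star n (X i))" for X
      using b \<phi> dn by (rule mat_point_in_elem_interval_origin_iff)
    have "(\<Prod>i=1..s. e i (d i) X) = (if mat_point b \<phi> s n X \<in> ?I then real b ^ ?D else 0)" for X
    proof (cases "mat_point b \<phi> s n X \<in> ?I")
      case True
      then have "(\<Prod>i=1..s. e i (d i) X) = (\<Prod>i=1..s. real b ^ d i)"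
        unfolding in_I by (intro prod.cong) (auto simp: e_def)
      then show ?thesis using True by (simp add: power_sum)
    next
      case False
      then obtain i where "i \<in> {1..s}" "e i (d i) X = 0"
        unfolding in_I by (auto simp: e_def)
      then show ?thesis using False by (auto intro: prod_zero)
    qed
    then have "(\<Sum>X\<in>P. 1 * (\<Prod>i=1..s. e i (d i) X))
        = real (card {X\<in>P. mat_point b \<phi> s n X \<in> ?I}) * real b ^ ?D"
      using fin by (simp add: sum.If_cases Int_def)
    also have "card {X\<in>P. mat_point b \<phi> s n X \<in> ?I}
        = card (mat_point b \<phi> s n ` {X\<in>P. mat_point b \<phi> s n X \<in> ?I})"
      using inj by (intro card_image[symmetric]) (auto intro: inj_on_subset)
    also have "mat_point b \<phi> s n ` {X\<in>P. mat_point b \<phi> s n X \<in> ?I} = ?S \<inter> ?I" by auto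
    also have "card (?S \<inter> ?I) = b ^ (m - ?D)"
      using net' b s d by (rule net_card_elem_interval_origin)
    finally show ?thesis using d by (simp flip: power_add)
  qed
  have "coeff (\<Sum>X\<in>P. smult 1 (\<Prod>i=1..s. p_poly b n (mu_star n (X i)))) k
      = (if k = 0 then real (b ^ m) else 0)"
  proof (rule coeff_sum_smult_prod_telescope[where K = "m - t" and e = e])
    fix i a and X :: "nat \<Rightarrow> nat \<Rightarrow> 'g"
    assume "a \<le> m - t"
    then show "coeff (p_poly b n (mu_star n (X i))) a
        = (if a = 0 then e i 0 X else e i a X - e i (a - 1) X)"
      using coeff_p_poly[OF mu_star_le[of n "X i"], of a b] nm by (simp add: e_def)
  qed (use k count in auto)
  then show ?thesis using k by (simp add: N_hat_def N_poly_def)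
qed

theorem mainTheorem6:
  fixes P :: "(nat \<Rightarrow> nat \<Rightarrow> 'g::{finite, ab_group_add}) set"
    and \<phi> :: "nat \<Rightarrow> 'g"
    and b s m n t :: nat
  assumes "b = CARD('g)" and "b \<ge> 2"
    and "s \<ge> 1" and "m \<ge> 1" and "n \<ge> m"
    and "bij_betw \<phi> {..<b} UNIV" and "\<phi> 0 = 0"
    and "P \<subseteq> mats s n" and "card P = b ^ m"
    and "is_strict_mat_net b \<phi> n t m s P"
  shows "int t \<ge> int m + 1 - int (min_weight b s n P)"
proof -
  let ?A = "{a\<in>{1..n * s}. N_hat b s n P a \<noteq> 0}"
  have "is_mat_net b \<phi> n t m s P" using assms(10) by (simp add: is_strict_mat_net_def)
  then have vanish: "N_hat b s n P k = 0" if "1 \<le> k" "k \<le> m - t" for k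
    using N_hat_eq_0_of_mat_net assms that by blast
  \<comment> \<open>The integer inequality follows from this one even if the natural subtraction
    truncates.\<close>
  have "m - t < min_weight b s n P"
  proof (cases "?A = {}")
    case True
    \<comment> \<open>With no nonzero coefficient the minimum is \<open>n * s + 1\<close> by
      convention, so \<open>m \<le> n * s\<close> suffices.\<close>
    have "m \<le> n * s" using \<open>n \<ge> m\<close> \<open>s \<ge> 1\<close> by (metis le_trans mult.right_neutral mult_le_mono)
    with True show ?thesis by (simp add: min_weight_def Let_def)
  next
    case False
    then have "Min ?A \<in> ?A" by (intro Min_in) auto
    with vanish have "m - t < Min ?A" by (auto simp: not_le[symmetric])
    moreover have "min_weight b s n P = Min ?A" using False
      by (simp add: min_weight_def Let_def del: Collect_empty_eq)
    ultimately show ?thesis by simp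
  qed
  then show ?thesis by linarith
qed

end
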